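(* Let $A_1$, $A_2$ be finite-dimensional complex vector spaces with $\mathbb{C}$-bases $(e_{1\cdot i})_i$, $(e_{2\cdot j})_j$ and associated real bases. Let $f:A_1\to A_2$ be an antilinear mapping with real matrix $(f^{qj}_{pi})$, $p,q\in\{0,1\}$, with respect to the associated real bases, i.e. for $x_2=f(x_1)$, $x_2^{qj}=\sum_{p,i} f^{qj}_{pi}x_1^{pi}$. Then, for every $x_1\in A_1$ and $x_2=f(x_1)$, with respect to the real bases the mapping has the form $$x_2^{0j}=\sum_i\left(f^{0j}_{0i}x_1^{0i}+f^{1j}_{0i}x_1^{1i}\right),\qquad x_2^{1j}=\sum_i\left(f^{1j}_{0i}x_1^{0i}-f^{0j}_{0i}x_1^{1i}\right),$$ and with respect to the complex bases it has the form $$x_2^j=\sum_i f^j_i\,(x_1^i)^*,\qquad f^j_i=f^{0j}_{0i}+f^{1j}_{0i}\,\mathrm{i},$$ where $z^*$ denotes the complex conjugate of $z\in\mathbb{C}$.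
   Context: For a complex vector space $A$ with $\mathbb{C}$-basis $(e_i)$, the associated real basis consists of the vectors $e_{0i}=e_i$ and $e_{1i}=\mathrm{i}\,e_i$ ($\mathrm{i}$ the imaginary unit). The complex coordinates $x^i\in\mathbb{C}$ and real coordinates $x^{0i},x^{1i}\in\mathbb{R}$ of $x\in A$ are defined by $x=\sum_i x^i e_i$, $x^i=x^{0i}+x^{1i}\mathrm{i}$. A mapping $f:A_1\to A_2$ is antilinear if it is additive and $f(ca)=c^*f(a)$ for all $c\in\mathbb{C}$, $a\in A_1$ (in particular $f$ is real linear). *)

theory Defs
  imports Complex_Main
begin

text \<open>
  A complex vector space is a type of class \<^class>\<open>ab_group_add\<close> with a scalar multiplication
  \<open>s\<close> such that \<^term>\<open>vector_space (s :: complex \<Rightarrow> 'v \<Rightarrow> 'v :: ab_group_add)\<close>.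
  A basis is a family \<open>e\<close> indexed by a finite set \<open>I\<close>, which may be empty, so that the zero
  space is included. Values of \<open>e\<close> outside \<open>I\<close> are irrelevant.
\<close>

definition basis_family ::
  "('k::field \<Rightarrow> 'v::ab_group_add \<Rightarrow> 'v) \<Rightarrow> 'i set \<Rightarrow> ('i \<Rightarrow> 'v) \<Rightarrow> bool" where
  "basis_family s I e \<longleftrightarrow> inj_on e I \<and> finite_dimensional_vector_space s (e ` I)"

definition coord ::
  "('k::field \<Rightarrow> 'v::ab_group_add \<Rightarrow> 'v) \<Rightarrow> 'i set \<Rightarrow> ('i \<Rightarrow> 'v) \<Rightarrow> 'v \<Rightarrow> 'i \<Rightarrow> 'k" where
  "coord s I e x i = module.representation s (e ` I) x (e i)"

lemma coord_expansion:
  assumes "basis_family s I e"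
  shows "(\<Sum>i\<in>I. s (coord s I e x i) (e i)) = x"
proof -
  interpret finite_dimensional_vector_space s "e ` I"
    using assms by (simp add: basis_family_def)
  have "inj_on e I" using assms by (simp add: basis_family_def)
  then have "(\<Sum>i\<in>I. s (coord s I e x i) (e i)) = (\<Sum>b\<in>e ` I. s (representation (e ` I) x b) b)"
    by (simp add: sum.reindex coord_def)
  also have "\<dots> = x"
    by (rule sum_representation_eq) (auto simp: independent_Basis span_Basis finite_Basis)
  finally show ?thesis .
qed

lemma coord_unique:
  assumes "basis_family s I e" and x: "(\<Sum>i\<in>I. s (c i) (e i)) = x" and "i \<in> I"
  shows "c i = coord s I e x i"
proof -
  interpret finite_dimensional_vector_space s "e ` I"
    using assms by (simp add: basis_family_def)
  have inj: "inj_on e I" using assms by (simp add: basis_family_def)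
  let ?d = "\<lambda>i. c i - coord s I e x i"
  have "(\<Sum>i\<in>I. s (?d i) (e i)) = 0"
    using x coord_expansion[OF assms(1), of x]
    by (simp add: scale_left_diff_distrib sum_subtractf)
  moreover have "(\<Sum>b\<in>e ` I. s (?d (the_inv_into I e b)) b) = (\<Sum>i\<in>I. s (?d i) (e i))"
    using inj by (simp add: sum.reindex the_inv_into_f_f)
  ultimately have "?d (the_inv_into I e (e i)) = 0"
    using independentD[OF independent_Basis finite_Basis order_refl,
        of "\<lambda>b. ?d (the_inv_into I e b)" "e i"] \<open>i \<in> I\<close> by simp
  then show ?thesis using inj \<open>i \<in> I\<close> by (simp add: the_inv_into_f_f)
qed

text \<open>The associated real basis, indexed by \<open>(p, i)\<close> with \<open>p \<in> {0, 1}\<close> and \<open>i \<in> I\<close>.\<close>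

definition real_basis ::
  "(complex \<Rightarrow> 'v::ab_group_add \<Rightarrow> 'v) \<Rightarrow> ('i \<Rightarrow> 'v) \<Rightarrow> nat \<Rightarrow> 'i \<Rightarrow> 'v" where
  "real_basis s e p i = (if p = 0 then e i else s \<i> (e i))"

definition real_coord ::
  "(complex \<Rightarrow> 'v::ab_group_add \<Rightarrow> 'v) \<Rightarrow> 'i set \<Rightarrow> ('i \<Rightarrow> 'v) \<Rightarrow> 'v \<Rightarrow> nat \<Rightarrow> 'i \<Rightarrow> real" where
  "real_coord s I e x p i = (if p = 0 then Re (coord s I e x i) else Im (coord s I e x i))"

definition restrict_scalars ::
  "(complex \<Rightarrow> 'v::ab_group_add \<Rightarrow> 'v) \<Rightarrow> real \<Rightarrow> 'v \<Rightarrow> 'v" where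
  "restrict_scalars s r = s (complex_of_real r)"

lemma real_basis_sum:
  assumes "vector_space s" and "finite I"
  shows "(\<Sum>(p, i)\<in>{0, 1} \<times> I. restrict_scalars s (c (p, i)) (real_basis s e p i))
       = (\<Sum>i\<in>I. s (Complex (c (0, i)) (c (1, i))) (e i))"
proof -
  interpret vector_space s by fact
  have "s (complex_of_real a) v + s (complex_of_real b) (s \<i> v) = s (Complex a b) v" for a b v
    by (simp add: Complex_eq scale_left_distrib mult.commute)
  then show ?thesis
    using assms(2)
    by (simp add: restrict_scalars_def real_basis_def sum.cartesian_product[symmetric]
        sum.distrib[symmetric])
qed

text \<open>
  Over the reals, \<^const>\<open>real_basis\<close> is a basis, and \<^const>\<open>real_coord\<close> gives the
  coordinates with respect to it.
\<close>

lemma basis_family_real_basis: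
  assumes "basis_family s I e"
  shows "basis_family (restrict_scalars s) ({0, 1} \<times> I) (\<lambda>(p, i). real_basis s e p i)"
proof -
  interpret finite_dimensional_vector_space s "e ` I"
    using assms by (simp add: basis_family_def)
  have vs: "vector_space s" by (rule vector_space_axioms)
  have inj: "inj_on e I" using assms by (simp add: basis_family_def)
  have fin: "finite I" using finite_Basis inj finite_imageD by blast
  let ?K = "{0, 1::nat} \<times> I"
  let ?b = "\<lambda>(p, i). real_basis s e p i"
  interpret R: vector_space "restrict_scalars s"
    by unfold_locales
      (simp_all add: restrict_scalars_def scale_right_distrib scale_left_distrib)
  have sum: "(\<Sum>k\<in>?K. restrict_scalars s (c k) (?b k))
      = (\<Sum>i\<in>I. s (Complex (c (0, i)) (c (1, i))) (e i))" for c
    using real_basis_sum[OF vs fin, of c e] by (simp add: case_prod_unfold)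
  have zero: "c k = 0" if 0: "(\<Sum>k\<in>?K. restrict_scalars s (c k) (?b k)) = 0" and k: "k \<in> ?K" for c k
  proof -
    have z: "Complex (c (0, i)) (c (1, i)) = 0" if "i \<in> I" for i
    proof -
      have "Complex (c (0, i)) (c (1, i)) = coord s I e 0 i"
        by (rule coord_unique[OF assms _ that, where c = "\<lambda>i. Complex (c (0, i)) (c (1, i))"])
          (use 0 sum[of c] in simp)
      moreover have "0 = coord s I e 0 i"
        by (rule coord_unique[OF assms _ that, where c = "\<lambda>i. 0"]) simp
      ultimately show ?thesis by simp
    qed
    from k obtain p i where "k = (p, i)" "p = 0 \<or> p = 1" "i \<in> I" by auto
    with z[of i] show ?thesis by (auto simp: complex_eq_iff)
  qed
  have finK: "finite ?K" using fin by simp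
  have injb: "inj_on ?b ?K"
  proof (rule inj_onI, rule ccontr)
    fix k l assume kl: "k \<in> ?K" "l \<in> ?K" "?b k = ?b l" "k \<noteq> l"
    define c :: "nat \<times> 'b \<Rightarrow> real" where "c m = (if m = k then 1 else if m = l then - 1 else 0)" for m
    have "(\<Sum>m\<in>?K. restrict_scalars s (c m) (?b m))
        = (\<Sum>m\<in>{k, l}. restrict_scalars s (c m) (?b m))"
      by (rule sum.mono_neutral_right) (use kl finK in \<open>auto simp: c_def\<close>)
    also have "\<dots> = 0" using kl by (simp add: c_def)
    finally have "c k = 0" using zero kl(1) by blast
    then show False by (simp add: c_def)
  qed
  have ind: "\<not> R.dependent (?b ` ?K)"
  proof (rule R.independent_if_scalars_zero)
    fix g v assume g: "(\<Sum>x\<in>?b ` ?K. restrict_scalars s (g x) x) = 0" and v: "v \<in> ?b ` ?K"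
    from v obtain k where k: "k \<in> ?K" "v = ?b k" by blast
    have "(\<Sum>k\<in>?K. restrict_scalars s (g (?b k)) (?b k)) = 0"
      using g injb by (simp add: sum.reindex)
    from zero[of "\<lambda>k. g (?b k)", OF this k(1)] k(2) show "g v = 0" by simp
  qed (use finK in simp)
  have "x \<in> R.span (?b ` ?K)" for x
  proof -
    let ?c = "\<lambda>(p, i). real_coord s I e x p i"
    have "x = (\<Sum>k\<in>?K. restrict_scalars s (?c k) (?b k))"
      using coord_expansion[OF assms, of x] sum[of ?c] by (simp add: real_coord_def)
    also have "\<dots> \<in> R.span (?b ` ?K)"
      by (rule R.span_sum, rule R.span_scale, rule R.span_base) blast
    finally show ?thesis .
  qed
  then have "R.span (?b ` ?K) = UNIV" by blast
  then have "finite_dimensional_vector_space (restrict_scalars s) (?b ` ?K)"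
    using finK ind by unfold_locales auto
  with injb show ?thesis by (simp add: basis_family_def)
qed

lemma real_coord_eq_coord:
  assumes "basis_family s I e" and "p \<in> {0, 1}" and "i \<in> I"
  shows "real_coord s I e x p i
       = coord (restrict_scalars s) ({0, 1} \<times> I) (\<lambda>(p, i). real_basis s e p i) x (p, i)"
proof -
  have vs: "vector_space s" and fin: "finite I"
    using assms(1) finite_imageD
    by (auto simp: basis_family_def finite_dimensional_vector_space_def
        finite_dimensional_vector_space_axioms_def)
  let ?c = "\<lambda>(p, i). real_coord s I e x p i"
  have "?c (p, i) = coord (restrict_scalars s) ({0, 1} \<times> I) (\<lambda>(p, i). real_basis s e p i) x (p, i)"
    by (rule coord_unique[OF basis_family_real_basis[OF assms(1)], where c = ?c])
      (use assms(2,3) real_basis_sum[OF vs fin, of ?c e] coord_expansion[OF assms(1), of x]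
        in \<open>simp_all add: real_coord_def case_prod_unfold cong: if_cong\<close>)
  then show ?thesis by simp
qed

definition antilinear ::
  "(complex \<Rightarrow> 'a::ab_group_add \<Rightarrow> 'a) \<Rightarrow> (complex \<Rightarrow> 'b::ab_group_add \<Rightarrow> 'b) \<Rightarrow> ('a \<Rightarrow> 'b) \<Rightarrow> bool"
where
  "antilinear s1 s2 f \<longleftrightarrow>
     (\<forall>a b. f (a + b) = f a + f b) \<and> (\<forall>c a. f (s1 c a) = s2 (cnj c) (f a))"

text \<open>The entry \<open>f\<^bsup>qj\<^esup>\<^bsub>pi\<^esub>\<close> is \<open>F q j p i\<close>.\<close>

definition real_matrix ::
  "(complex \<Rightarrow> 'a::ab_group_add \<Rightarrow> 'a) \<Rightarrow> 'i set \<Rightarrow> ('i \<Rightarrow> 'a) \<Rightarrow>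
   (complex \<Rightarrow> 'b::ab_group_add \<Rightarrow> 'b) \<Rightarrow> 'j set \<Rightarrow> ('j \<Rightarrow> 'b) \<Rightarrow>
   ('a \<Rightarrow> 'b) \<Rightarrow> (nat \<Rightarrow> 'j \<Rightarrow> nat \<Rightarrow> 'i \<Rightarrow> real) \<Rightarrow> bool" where
  "real_matrix s1 I e1 s2 J e2 f F \<longleftrightarrow>
     (\<forall>x. \<forall>q\<in>{0, 1}. \<forall>j\<in>J.
        real_coord s2 J e2 (f x) q j = (\<Sum>p\<in>{0, 1}. \<Sum>i\<in>I. F q j p i * real_coord s1 I e1 x p i))"

end

theory Submission
  imports Defs
begin

text \<open>
  An antilinear map is determined by the images of the complex basis vectors, and the complex
  coordinates of these images are read off the columns \<open>(0, i)\<close> of the real matrix. The real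
  form is the separation of the complex form into real and imaginary parts.
\<close>

lemma coord_scale:
  assumes "basis_family s I e"
  shows "coord s I e (s c x) i = c * coord s I e x i"
proof -
  interpret finite_dimensional_vector_space s "e ` I"
    using assms by (simp add: basis_family_def)
  show ?thesis
    by (simp add: coord_def representation_scale independent_Basis span_Basis)
qed

lemma coord_sum:
  assumes "basis_family s I e"
  shows "coord s I e (\<Sum>k\<in>K. v k) i = (\<Sum>k\<in>K. coord s I e (v k) i)"
proof -
  interpret finite_dimensional_vector_space s "e ` I"
    using assms by (simp add: basis_family_def)
  show ?thesis
    by (simp add: coord_def representation_sum independent_Basis span_Basis)
qed

lemma coord_basis:
  assumes "basis_family s I e" and "i \<in> I" and "k \<in> I"
  shows "coord s I e (e i) k = (if k = i then 1 else 0)"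
proof -
  interpret finite_dimensional_vector_space s "e ` I"
    using assms by (simp add: basis_family_def)
  have "inj_on e I" using assms by (simp add: basis_family_def)
  then show ?thesis
    using assms(2,3) by (auto simp: coord_def representation_basis independent_Basis inj_on_eq_iff)
qed

lemma coord_eq_Complex:
  "coord s I e x i = Complex (real_coord s I e x 0 i) (real_coord s I e x 1 i)"
  by (simp add: real_coord_def)

lemma antilinear_sum:
  assumes "antilinear s1 s2 f"
  shows "f (\<Sum>k\<in>K. v k) = (\<Sum>k\<in>K. f (v k))"
proof -
  have add: "f (a + b) = f a + f b" for a b
    using assms by (simp add: antilinear_def)
  \<comment> \<open>The value at 0 covers the empty sum, and also infinite \<open>K\<close>, where
    both sums default to 0.\<close>
  from add[of 0 0] have "f 0 = 0" by simp
  with add show ?thesis by (simp add: sum_comp_morphism[of f, unfolded comp_def, symmetric])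
qed

text \<open>As a member of the associated real basis, \<open>e1 i\<close> has index
  \<open>(0, i)\<close>. Its image therefore has column \<open>(0, i)\<close> of \<open>F\<close> as
  real coordinates, and the entries for \<open>q = 0\<close> and \<open>q = 1\<close> are the real
  and imaginary parts.\<close>

lemma coord_antilinear_basis:
  assumes "basis_family s1 I e1" and "real_matrix s1 I e1 s2 J e2 f F"
    and "i \<in> I" and "j \<in> J"
  shows "coord s2 J e2 (f (e1 i)) j = Complex (F 0 j 0 i) (F 1 j 0 i)"
proof -
  interpret finite_dimensional_vector_space s1 "e1 ` I"
    using assms(1) by (simp add: basis_family_def)
  \<comment> \<open>Injectivity of \<open>e1\<close> carries finiteness of the basis over to the
    index set. The sum over the Kronecker delta below relies on it, since an infinite sum would be
    0.\<close>
  have "finite I"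
    using assms(1) finite_Basis finite_imageD by (auto simp: basis_family_def)
  have "real_coord s2 J e2 (f (e1 i)) q j = F q j 0 i" if "q \<in> {0, 1}" for q
  proof -
    have "real_coord s2 J e2 (f (e1 i)) q j
        = (\<Sum>p\<in>{0, 1}. \<Sum>k\<in>I. F q j p k * real_coord s1 I e1 (e1 i) p k)"
      using assms(2,4) that unfolding real_matrix_def by blast
    \<comment> \<open>The complex coordinates of \<open>e1 i\<close> are 0 or 1, hence real, so the
      terms with \<open>p = 1\<close> vanish.\<close>
    also have "\<dots> = (\<Sum>k\<in>I. if k = i then F q j 0 k else 0)"
      using assms(1,3)
      by (auto simp: real_coord_def coord_basis sum.distrib[symmetric] intro!: sum.cong)
    also have "\<dots> = F q j 0 i"
      using \<open>finite I\<close> \<open>i \<in> I\<close> by simp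
    finally show ?thesis .
  qed
  then show ?thesis by (simp add: coord_eq_Complex)
qed

text \<open>When \<open>f\<close> is applied to the expansion of \<open>x\<close> in the complex
  basis, each coordinate comes out conjugated. Linearity of the coordinates in the target space then
  leaves only the images of basis vectors.\<close>

lemma coord_antilinear:
  assumes "basis_family s1 I e1" and "basis_family s2 J e2"
    and "antilinear s1 s2 f" and "real_matrix s1 I e1 s2 J e2 f F" and "j \<in> J"
  shows "coord s2 J e2 (f x) j = (\<Sum>i\<in>I. Complex (F 0 j 0 i) (F 1 j 0 i) * cnj (coord s1 I e1 x i))"
proof -
  have "f x = f (\<Sum>i\<in>I. s1 (coord s1 I e1 x i) (e1 i))"
    by (simp add: coord_expansion[OF assms(1)])
  also have "\<dots> = (\<Sum>i\<in>I. s2 (cnj (coord s1 I e1 x i)) (f (e1 i)))"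
    using assms(3) by (simp add: antilinear_sum[OF assms(3)] antilinear_def)
  finally have "coord s2 J e2 (f x) j
      = (\<Sum>i\<in>I. cnj (coord s1 I e1 x i) * coord s2 J e2 (f (e1 i)) j)"
    by (simp add: coord_sum[OF assms(2)] coord_scale[OF assms(2)])
  then show ?thesis
    using coord_antilinear_basis[OF assms(1,4) _ assms(5)] by (simp add: mult.commute)
qed

theorem theorem5p4:
  fixes s1 :: "complex \<Rightarrow> 'a::ab_group_add \<Rightarrow> 'a"
    and s2 :: "complex \<Rightarrow> 'b::ab_group_add \<Rightarrow> 'b"
    and I :: "'i set" and J :: "'j set"
    and e1 :: "'i \<Rightarrow> 'a" and e2 :: "'j \<Rightarrow> 'b"
    and f :: "'a \<Rightarrow> 'b"
    and F :: "nat \<Rightarrow> 'j \<Rightarrow> nat \<Rightarrow> 'i \<Rightarrow> real"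
    and x1 :: 'a and x2 :: 'b
  assumes "vector_space s1" and "vector_space s2"
    and "basis_family s1 I e1" and "basis_family s2 J e2"
    and "antilinear s1 s2 f"
    and "real_matrix s1 I e1 s2 J e2 f F"
    and "x2 = f x1"
  shows "(\<forall>j\<in>J.
            real_coord s2 J e2 x2 0 j =
              (\<Sum>i\<in>I. F 0 j 0 i * real_coord s1 I e1 x1 0 i + F 1 j 0 i * real_coord s1 I e1 x1 1 i) \<and>
            real_coord s2 J e2 x2 1 j =
              (\<Sum>i\<in>I. F 1 j 0 i * real_coord s1 I e1 x1 0 i - F 0 j 0 i * real_coord s1 I e1 x1 1 i)) \<and>
         (\<forall>j\<in>J.
            coord s2 J e2 x2 j =
              (\<Sum>i\<in>I. (complex_of_real (F 0 j 0 i) + complex_of_real (F 1 j 0 i) * \<i>)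
                        * cnj (coord s1 I e1 x1 i)))"
proof -
  have c: "coord s2 J e2 x2 j
      = (\<Sum>i\<in>I. Complex (F 0 j 0 i) (F 1 j 0 i) * cnj (coord s1 I e1 x1 i))" if "j \<in> J" for j
    unfolding assms(7) by (rule coord_antilinear[OF assms(3-6) that])
  show ?thesis
  proof (intro conjI ballI)
    fix j assume "j \<in> J"
    note c = c[OF this]
    \<comment> \<open>Real part of (a + b \<i>)(u - v \<i>), namely a u + b v.\<close>
    show "real_coord s2 J e2 x2 0 j
        = (\<Sum>i\<in>I. F 0 j 0 i * real_coord s1 I e1 x1 0 i + F 1 j 0 i * real_coord s1 I e1 x1 1 i)"
      by (simp add: real_coord_def c)
    \<comment> \<open>Imaginary part of the same product, b u - a v; the minus sign comes from the
      conjugation.\<close>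
    show "real_coord s2 J e2 x2 1 j
        = (\<Sum>i\<in>I. F 1 j 0 i * real_coord s1 I e1 x1 0 i - F 0 j 0 i * real_coord s1 I e1 x1 1 i)"
      by (simp add: real_coord_def c)
    show "coord s2 J e2 x2 j
        = (\<Sum>i\<in>I. (complex_of_real (F 0 j 0 i) + complex_of_real (F 1 j 0 i) * \<i>)
                    * cnj (coord s1 I e1 x1 i))"
      by (simp add: c Complex_eq mult.commute)
  qed
qed

end
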